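(* Let $$G=\langle a,b,c\mid a^3=b^3=c^3=e,\ b^{-1}a^{-1}ba=c,\ ac=ca,\ bc=cb\rangle .$$ If $S=\partial\{e,a,b,c\}$, then $$i\bigl(\operatorname{Cay}(G,S)\bigr)=3\qquad\text{and}\qquad \alpha\bigl(\operatorname{Cay}(G,S)\bigr)=6 .$$
   Context: For a non-empty subset $A$ of a group $G$ with identity $e$, $\partial A=A^{-1}A\setminus\{e\}$, where $A^{-1}A=\{x^{-1}y\mid x,y\in A\}$. For a subset $S\subseteq G$ with $e\notin S$ and $S=S^{-1}$, the (left) Cayley graph $\operatorname{Cay}(G,S)$ is the simple graph with vertex set $G$ in which $u,v$ are adjacent if and only if $vu^{-1}\in S$. For a finite graph $\Gamma$, $\alpha(\Gamma)$ is the size of a largest independent set and $i(\Gamma)$ is the size of a smallest maximal (with respect to inclusion) independent set. *)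

theory Defs
  imports "HOL-Algebra.Group" "Graph_Theory.Pair_Digraph"
begin

section \<open>Groups given by generators and relations\<close>

text \<open>
  A word is a list of signed letters: \<open>(x, True)\<close> stands for the generator \<open>x\<close> and
  \<open>(x, False)\<close> for its formal inverse.  A set \<open>R\<close> of pairs of words represents the defining
  relations \<open>l = r\<close>, for \<open>(l, r) \<in> R\<close>.  The presented group consists of the words over the type
  of generators modulo the least congruence that contains \<open>R\<close> and free cancellation, which is the
  same as the quotient of the free group by the normal closure of the elements \<open>l r\<^sup>-\<^sup>1\<close>.
\<close>

type_synonym 'g word = "('g \<times> bool) list"

inductive word_eq :: "('g word \<times> 'g word) set \<Rightarrow> 'g word \<Rightarrow> 'g word \<Rightarrow> bool"
  for R :: "('g word \<times> 'g word) set" where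
  refl: "word_eq R u u"
| sym: "word_eq R u v \<Longrightarrow> word_eq R v u"
| trans: "word_eq R u v \<Longrightarrow> word_eq R v w \<Longrightarrow> word_eq R u w"
| cancel: "word_eq R (u @ [(x, s), (x, \<not> s)] @ v) (u @ v)"
| relation: "(l, r) \<in> R \<Longrightarrow> word_eq R (u @ l @ v) (u @ r @ v)"

definition word_class :: "('g word \<times> 'g word) set \<Rightarrow> 'g word \<Rightarrow> 'g word set" where
  "word_class R u = {v. word_eq R u v}"

definition presented_group :: "('g word \<times> 'g word) set \<Rightarrow> 'g word set monoid" where
  "presented_group R =
     \<lparr>carrier = range (word_class R),
      monoid.mult = (\<lambda>U V. {w. \<exists>u\<in>U. \<exists>v\<in>V. word_eq R (u @ v) w}),
      one = word_class R []\<rparr>"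

definition pgen :: "('g word \<times> 'g word) set \<Rightarrow> 'g \<Rightarrow> 'g word set" where
  "pgen R x = word_class R [(x, True)]"

lemma word_class_eq_iff: "word_class R u = word_class R v \<longleftrightarrow> word_eq R u v"
  unfolding word_class_def
  by (metis (no_types, lifting) Collect_cong mem_Collect_eq word_eq.refl word_eq.sym word_eq.trans)

lemma word_eq_append_left: "word_eq R u v \<Longrightarrow> word_eq R (w @ u) (w @ v)"
proof (induction rule: word_eq.induct)
  case (cancel u x s v)
  show ?case using word_eq.cancel[of R "w @ u" x s v] by simp
next
  case (relation l r u v)
  show ?case using word_eq.relation[OF relation, of "w @ u" v] by simp
qed (blast intro: word_eq.intros)+

lemma word_eq_append_right: "word_eq R u v \<Longrightarrow> word_eq R (u @ w) (v @ w)"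
proof (induction rule: word_eq.induct)
  case (cancel u x s v)
  show ?case using word_eq.cancel[of R u x s "v @ w"] by simp
next
  case (relation l r u v)
  show ?case using word_eq.relation[OF relation, of u "v @ w"] by simp
qed (blast intro: word_eq.intros)+

lemma word_eq_append:
  "word_eq R u u' \<Longrightarrow> word_eq R v v' \<Longrightarrow> word_eq R (u @ v) (u' @ v')"
  by (blast intro: word_eq.trans word_eq_append_left word_eq_append_right)

lemma presented_group_simps:
  "carrier (presented_group R) = range (word_class R)"
  "word_class R u \<otimes>\<^bsub>presented_group R\<^esub> word_class R v = word_class R (u @ v)"
  "\<one>\<^bsub>presented_group R\<^esub> = word_class R []"
  unfolding presented_group_def word_class_def
  by (auto intro: word_eq.refl word_eq.trans word_eq_append)

definition word_inv :: "'g word \<Rightarrow> 'g word" where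
  "word_inv u = rev (map (\<lambda>(x, s). (x, \<not> s)) u)"

lemma word_inv_left: "word_eq R (word_inv u @ u) []"
proof (induction u)
  case Nil
  show ?case by (simp add: word_inv_def word_eq.refl)
next
  case (Cons p u)
  obtain x s where p: "p = (x, s)" by fastforce
  have "word_eq R (word_inv (p # u) @ p # u) (word_inv u @ u)"
    using word_eq.cancel[of R "word_inv u" x "\<not> s" u] by (simp add: word_inv_def p)
  then show ?case using Cons.IH word_eq.trans by blast
qed

lemma group_presented_group: "group (presented_group R)"
proof (rule groupI)
  fix x assume "x \<in> carrier (presented_group R)"
  then obtain u where "x = word_class R u" by (auto simp: presented_group_simps)
  then have "word_class R (word_inv u) \<otimes>\<^bsub>presented_group R\<^esub> x = \<one>\<^bsub>presented_group R\<^esub>"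
    by (simp add: presented_group_simps word_class_eq_iff word_inv_left)
  then show "\<exists>y\<in>carrier (presented_group R). y \<otimes>\<^bsub>presented_group R\<^esub> x = \<one>\<^bsub>presented_group R\<^esub>"
    by (auto simp: presented_group_simps)
qed (auto simp: presented_group_simps)

datatype gen = Ga | Gb | Gc

text \<open>The relations \<open>a\<^sup>3 = b\<^sup>3 = c\<^sup>3 = e\<close>, \<open>b\<^sup>-\<^sup>1 a\<^sup>-\<^sup>1 b a = c\<close>, \<open>a c = c a\<close> and \<open>b c = c b\<close>.\<close>

definition heisenberg_relations :: "(gen word \<times> gen word) set" where
  "heisenberg_relations =
     {([(Ga, True), (Ga, True), (Ga, True)], []),
      ([(Gb, True), (Gb, True), (Gb, True)], []),
      ([(Gc, True), (Gc, True), (Gc, True)], []),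
      ([(Gb, False), (Ga, False), (Gb, True), (Ga, True)], [(Gc, True)]),
      ([(Ga, True), (Gc, True)], [(Gc, True), (Ga, True)]),
      ([(Gb, True), (Gc, True)], [(Gc, True), (Gb, True)])}"

lemma (in group) heisenberg_normal_form_left:
  assumes car: "a \<in> carrier G" "b \<in> carrier G" "c \<in> carrier G"
    and ba: "b \<otimes> a = a \<otimes> b \<otimes> c" and ac: "a \<otimes> c = c \<otimes> a" and bc: "b \<otimes> c = c \<otimes> b"
    and x: "x \<in> {a, b, c}"
  shows "\<exists>i' j' k'. x \<otimes> (a [^] (i::nat) \<otimes> b [^] (j::nat) \<otimes> c [^] (k::nat))
           = a [^] (i'::nat) \<otimes> b [^] (j'::nat) \<otimes> c [^] (k'::nat)"
proof -
  have ca: "c \<otimes> a [^] n = a [^] n \<otimes> c" and cb: "c \<otimes> b [^] n = b [^] n \<otimes> c"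
    for n :: nat
    using group_commutes_pow[of a c n] group_commutes_pow[of b c n] car ac bc by simp_all
  have b_c: "b \<otimes> c [^] n = c [^] n \<otimes> b" for n :: nat
    using group_commutes_pow[of c b n] car bc by simp
  have cn_b: "c [^] n \<otimes> b [^] m = b [^] m \<otimes> c [^] n" for n m :: nat
    using group_commutes_pow[of b "c [^] n" m] b_c car by simp
  have c_a: "c [^] n \<otimes> a = a \<otimes> c [^] n" for n :: nat
    using group_commutes_pow[of c a n] car ac by simp
  have ban: "b \<otimes> a [^] n = a [^] n \<otimes> (b \<otimes> c [^] n)" for n :: nat
  proof (induction n)
    case (Suc n)
    have "b \<otimes> a [^] Suc n = (b \<otimes> a [^] n) \<otimes> a" using car by (simp add: m_assoc)
    also have "\<dots> = a [^] n \<otimes> (b \<otimes> (c [^] n \<otimes> a))" using car Suc by (simp add: m_assoc)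
    also have "\<dots> = a [^] n \<otimes> ((b \<otimes> a) \<otimes> c [^] n)" using car by (simp add: m_assoc c_a)
    also have "\<dots> = a [^] Suc n \<otimes> (b \<otimes> (c \<otimes> c [^] n))" using car ba by (simp add: m_assoc)
    also have "c \<otimes> c [^] n = c [^] Suc n" using car by (metis nat_pow_Suc2)
    finally show ?case .
  qed (use car in simp)
  consider "x = a" | "x = b" | "x = c" using x by blast
  then show ?thesis
  proof cases
    case 1
    have "x \<otimes> (a [^] i \<otimes> b [^] j \<otimes> c [^] k) = a [^] Suc i \<otimes> b [^] j \<otimes> c [^] k"
      unfolding 1 nat_pow_Suc2[OF car(1)] using car by (simp add: m_assoc)
    then show ?thesis by blast
  next
    case 2
    have "x \<otimes> (a [^] i \<otimes> b [^] j \<otimes> c [^] k) = (b \<otimes> a [^] i) \<otimes> (b [^] j \<otimes> c [^] k)"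
      unfolding 2 using car by (simp add: m_assoc)
    also have "\<dots> = a [^] i \<otimes> (b \<otimes> ((c [^] i \<otimes> b [^] j) \<otimes> c [^] k))"
      using car by (simp add: ban m_assoc)
    also have "\<dots> = a [^] i \<otimes> ((b \<otimes> b [^] j) \<otimes> (c [^] i \<otimes> c [^] k))"
      using car by (simp add: cn_b m_assoc)
    also have "\<dots> = a [^] i \<otimes> b [^] Suc j \<otimes> c [^] (i + k)"
      unfolding nat_pow_Suc2[OF car(2)] using car by (simp add: m_assoc nat_pow_mult)
    finally show ?thesis by blast
  next
    case 3
    have "x \<otimes> (a [^] i \<otimes> b [^] j \<otimes> c [^] k) = (c \<otimes> a [^] i) \<otimes> (b [^] j \<otimes> c [^] k)"
      unfolding 3 using car by (simp add: m_assoc)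
    also have "\<dots> = a [^] i \<otimes> ((c \<otimes> b [^] j) \<otimes> c [^] k)"
      using car by (simp add: ca m_assoc)
    also have "\<dots> = a [^] i \<otimes> b [^] j \<otimes> (c \<otimes> c [^] k)"
      using car by (simp add: cb m_assoc)
    also have "\<dots> = a [^] i \<otimes> b [^] j \<otimes> c [^] Suc k"
      unfolding nat_pow_Suc2[OF car(3)] ..
    finally show ?thesis by blast
  qed
qed

lemma (in group) pow_mod_3:
  assumes "x \<in> carrier G" and "x \<otimes> (x \<otimes> x) = \<one>"
  shows "x [^] (n::nat) = x [^] (n mod 3)"
proof -
  have "x [^] (3::nat) = \<one>" using assms by (simp add: numeral_3_eq_3 m_assoc)
  then have "x [^] (3 * (n div 3)) = \<one>"
    using assms(1) by (metis nat_pow_one nat_pow_pow)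
  then have "x [^] (3 * (n div 3) + n mod 3) = x [^] (n mod 3)"
    using assms(1) nat_pow_mult[of x "3 * (n div 3)" "n mod 3"] by (simp del: mult_div_mod_eq)
  then show ?thesis by simp
qed

lemma finite_heisenberg: "finite (carrier (presented_group heisenberg_relations))"
proof -
  define R where "R = heisenberg_relations"
  define G where "G = presented_group R"
  interpret group G unfolding G_def by (rule group_presented_group)
  note simps = presented_group_simps[of R, folded G_def]
  define N where "N g = word_class R [(g, False)]" for g
  let ?a = "pgen R Ga" and ?b = "pgen R Gb" and ?c = "pgen R Gc"
  have car: "pgen R g \<in> carrier G" "N g \<in> carrier G" for g
    by (auto simp: simps pgen_def N_def)
  have NP: "N g \<otimes>\<^bsub>G\<^esub> pgen R g = \<one>\<^bsub>G\<^esub>" for g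
    using word_eq.cancel[of R "[]" g False "[]"] by (simp add: simps pgen_def N_def word_class_eq_iff)
  have rel: "word_class R l = word_class R r" if "(l, r) \<in> R" for l r
    using word_eq.relation[OF that, of "[]" "[]"] by (simp add: word_class_eq_iff)
  have cube: "pgen R g \<otimes>\<^bsub>G\<^esub> (pgen R g \<otimes>\<^bsub>G\<^esub> pgen R g) = \<one>\<^bsub>G\<^esub>" for g
  proof -
    have "([(g, True), (g, True), (g, True)], []) \<in> R"
      by (cases g) (simp_all add: R_def heisenberg_relations_def)
    from rel[OF this] show ?thesis by (simp add: simps pgen_def)
  qed
  have comm: "N Gb \<otimes>\<^bsub>G\<^esub> (N Ga \<otimes>\<^bsub>G\<^esub> (?b \<otimes>\<^bsub>G\<^esub> ?a)) = ?c"
    and ac: "?a \<otimes>\<^bsub>G\<^esub> ?c = ?c \<otimes>\<^bsub>G\<^esub> ?a" and bc: "?b \<otimes>\<^bsub>G\<^esub> ?c = ?c \<otimes>\<^bsub>G\<^esub> ?b"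
    by (auto simp: simps pgen_def N_def intro!: rel) (auto simp: R_def heisenberg_relations_def)
  have N_inv: "N g = inv\<^bsub>G\<^esub> pgen R g" for g
    using inv_equality[OF NP] car by simp
  have ba: "?b \<otimes>\<^bsub>G\<^esub> ?a = ?a \<otimes>\<^bsub>G\<^esub> ?b \<otimes>\<^bsub>G\<^esub> ?c"
  proof -
    have "x \<otimes>\<^bsub>G\<^esub> (inv\<^bsub>G\<^esub> x \<otimes>\<^bsub>G\<^esub> z) = z" if "x \<in> carrier G" "z \<in> carrier G" for x z
      using that by (simp flip: m_assoc)
    then show ?thesis unfolding comm[symmetric] N_inv using car by (simp add: m_assoc)
  qed
  have N_sq: "N g = pgen R g \<otimes>\<^bsub>G\<^esub> pgen R g" for g
    unfolding N_inv using inv_equality[of "pgen R g \<otimes>\<^bsub>G\<^esub> pgen R g" "pgen R g"] cube car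
    by (simp add: m_assoc)
  define F where "F = (\<lambda>(i::nat, j::nat, k::nat). ?a [^]\<^bsub>G\<^esub> i \<otimes>\<^bsub>G\<^esub> ?b [^]\<^bsub>G\<^esub> j \<otimes>\<^bsub>G\<^esub> ?c [^]\<^bsub>G\<^esub> k)"
  have step: "pgen R g \<otimes>\<^bsub>G\<^esub> x \<in> range F" if x_in: "x \<in> range F" for g x
  proof -
    obtain t where t: "x = F t" using x_in by blast
    obtain i j k where "t = (i, j, k)" by (cases t)
    with t have x: "x = F (i, j, k)" by simp
    have "pgen R g \<in> {?a, ?b, ?c}" by (cases g) auto
    from heisenberg_normal_form_left[OF car(1) car(1) car(1) ba ac bc this, of i j k]
    obtain i' j' k' where "pgen R g \<otimes>\<^bsub>G\<^esub> x = F (i', j', k')" by (auto simp: x F_def)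
    then show ?thesis by blast
  qed
  have in_range: "word_class R u \<in> range F" for u
  proof (induction u)
    case Nil
    have "word_class R [] = F (0, 0, 0)" by (simp add: F_def simps)
    then show ?case by blast
  next
    case (Cons p u)
    obtain g s where p: "p = (g, s)" by fastforce
    have "word_class R (p # u) = (if s then pgen R g else N g) \<otimes>\<^bsub>G\<^esub> word_class R u"
      by (simp add: p pgen_def N_def simps)
    moreover have "word_class R u \<in> carrier G" by (simp add: simps)
    ultimately have "word_class R (p # u) \<in> {pgen R g \<otimes>\<^bsub>G\<^esub> word_class R u,
        pgen R g \<otimes>\<^bsub>G\<^esub> (pgen R g \<otimes>\<^bsub>G\<^esub> word_class R u)}"
      using car by (simp add: N_sq m_assoc)
    then show ?case using step[OF Cons.IH] step[OF step[OF Cons.IH]] by blast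
  qed
  have in_image: "F t \<in> F ` ({..<3} \<times> {..<3} \<times> {..<3})" for t
  proof -
    obtain i j k where t: "t = (i, j, k)" by (cases t)
    have "F t = F (i mod 3, j mod 3, k mod 3)"
      unfolding t F_def prod.case
      by (intro arg_cong2[where f = "monoid.mult G"] pow_mod_3 car cube)
    moreover have "(i mod 3, j mod 3, k mod 3) \<in> {..<3} \<times> {..<3} \<times> {..<3}" by simp
    ultimately show ?thesis by blast
  qed
  have "range F \<subseteq> F ` ({..<3} \<times> {..<3} \<times> {..<3})"
    by (rule image_subsetI) (rule in_image)
  moreover have "carrier G \<subseteq> range F"
    unfolding simps(1) by (rule image_subsetI) (rule in_range)
  ultimately have "carrier G \<subseteq> F ` ({..<3} \<times> {..<3} \<times> {..<3})" by (rule order_trans[rotated])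
  then show ?thesis unfolding G_def R_def by (rule finite_subset) simp
qed

section \<open>Cayley graphs\<close>

definition difference_set :: "('a, 'm) monoid_scheme \<Rightarrow> 'a set \<Rightarrow> 'a set" where
  "difference_set G A = {inv\<^bsub>G\<^esub> x \<otimes>\<^bsub>G\<^esub> y | x y. x \<in> A \<and> y \<in> A} - {\<one>\<^bsub>G\<^esub>}"

text \<open>An undirected edge \<open>{u, v}\<close> is represented by the two arcs \<open>(u, v)\<close> and \<open>(v, u)\<close>.\<close>

definition cayley_graph :: "('a, 'm) monoid_scheme \<Rightarrow> 'a set \<Rightarrow> 'a pair_pre_digraph" where
  "cayley_graph G S =
     \<lparr>pverts = carrier G,
      parcs = {(u, v). u \<in> carrier G \<and> v \<in> carrier G \<and> v \<otimes>\<^bsub>G\<^esub> inv\<^bsub>G\<^esub> u \<in> S}\<rparr>"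

lemma (in group) cayley_graph_simple:
  assumes "\<one> \<notin> S" and "\<And>s. s \<in> S \<Longrightarrow> inv s \<in> S"
  shows "pair_bidirected_digraph (cayley_graph G S)"
proof unfold_locales
  show "symmetric (with_proj (cayley_graph G S))"
    unfolding symmetric_def with_proj_simps
  proof (rule symI)
    fix u v assume "(u, v) \<in> parcs (cayley_graph G S)"
    then have uv: "u \<in> carrier G" "v \<in> carrier G" "v \<otimes> inv u \<in> S"
      by (auto simp: cayley_graph_def)
    then have "inv (v \<otimes> inv u) = u \<otimes> inv v" by (simp add: inv_mult_group)
    then show "(v, u) \<in> parcs (cayley_graph G S)"
      using uv assms(2)[OF uv(3)] by (simp add: cayley_graph_def)
  qed
qed (use assms(1) in \<open>auto simp: cayley_graph_def\<close>)

lemma (in group) difference_set_cayley_graph_simple: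
  assumes "A \<subseteq> carrier G"
  shows "pair_bidirected_digraph (cayley_graph G (difference_set G A))"
proof (rule cayley_graph_simple)
  fix s assume "s \<in> difference_set G A"
  then obtain x y where xy: "x \<in> A" "y \<in> A" "s = inv x \<otimes> y" "s \<noteq> \<one>"
    by (auto simp: difference_set_def)
  then have car: "x \<in> carrier G" "y \<in> carrier G" using assms by auto
  then have "inv s = inv y \<otimes> x" using xy by (simp add: inv_mult_group)
  moreover have "inv s \<noteq> \<one>" using xy car by simp
  ultimately show "inv s \<in> difference_set G A" using xy by (auto simp: difference_set_def)
qed (simp add: difference_set_def)

section \<open>Independent sets\<close>

definition independent_set :: "'a pair_pre_digraph \<Rightarrow> 'a set \<Rightarrow> bool" where
  "independent_set \<Gamma> I \<longleftrightarrow> I \<subseteq> pverts \<Gamma> \<and> (\<forall>u\<in>I. \<forall>v\<in>I. (u, v) \<notin> parcs \<Gamma>)"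

definition maximal_independent_set :: "'a pair_pre_digraph \<Rightarrow> 'a set \<Rightarrow> bool" where
  "maximal_independent_set \<Gamma> I \<longleftrightarrow>
     independent_set \<Gamma> I \<and> (\<forall>J. independent_set \<Gamma> J \<and> I \<subseteq> J \<longrightarrow> J = I)"

text \<open>The following two numbers are meaningful for finite graphs only.\<close>

definition independence_number :: "'a pair_pre_digraph \<Rightarrow> nat" where
  "independence_number \<Gamma> = Max {card I | I. independent_set \<Gamma> I}"

definition independent_domination_number :: "'a pair_pre_digraph \<Rightarrow> nat" where
  "independent_domination_number \<Gamma> = Min {card I | I. maximal_independent_set \<Gamma> I}"

end

theory Submission
  imports Defs
begin

text \<open>
  Let \<open>A = {e, a, b, c}\<close>.  Two distinct vertices \<open>u\<close>, \<open>v\<close> are adjacent if and only if \<open>A u\<close> and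
  \<open>A v\<close> meet, so an independent set \<open>I\<close> satisfies \<open>4 |I| \<le> |G| = 27\<close>.  Every closed neighbourhood
  has at most \<open>1 + 4 \<cdot> 3 = 13\<close> elements, so a maximal independent set satisfies \<open>27 \<le> 13 |I|\<close>.
  The resulting bounds \<open>|I| \<le> 6\<close> and \<open>|I| \<ge> 3\<close> are attained, the latter by the cyclic subgroup
  generated by \<open>a b c\<close>.
\<close>

section \<open>Independent sets in Cayley graphs of difference sets\<close>

text \<open>A vertex outside \<open>I\<close> without a neighbour in \<open>I\<close> could be added
  to \<open>I\<close>. Arcs leaving \<open>I\<close> are the only ones to exclude, because arcs are
  symmetric and there are no loops. A quantifier over all supersets becomes one over
  vertices.\<close>

lemma (in pair_bidirected_digraph) maximal_independent_set_iff_dominating: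
  "maximal_independent_set G I \<longleftrightarrow>
     independent_set G I \<and> (\<forall>v\<in>pverts G. v \<in> I \<or> (\<exists>u\<in>I. (u, v) \<in> parcs G))"
    (is "?M \<longleftrightarrow> ?I \<and> ?D")
proof (intro iffI conjI ballI)
  assume M: ?M
  then show ?I by (simp add: maximal_independent_set_def)
  fix v assume v: "v \<in> pverts G"
  show "v \<in> I \<or> (\<exists>u\<in>I. (u, v) \<in> parcs G)"
  proof (rule ccontr)
    assume neg: "\<not> (v \<in> I \<or> (\<exists>u\<in>I. (u, v) \<in> parcs G))"
    have "independent_set G (insert v I)"
      using neg v \<open>?I\<close> no_loops arcs_symmetric by (fastforce simp: independent_set_def)
    then show False using M neg unfolding maximal_independent_set_def by blast
  qed
next
  assume "?I \<and> ?D"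
  then show ?M unfolding maximal_independent_set_def independent_set_def by blast
qed

context group
begin

text \<open>Clearing both inverses in \<open>v \<otimes> inv u = inv x \<otimes> y\<close> gives the
  equation, and the removal of the identity from the difference set becomes
  \<open>u \<noteq> v\<close>. This form without inverses serves both the counting and the
  evaluation on triples.\<close>

lemma parcs_cayley_graph_difference_set:
  assumes A: "A \<subseteq> carrier G" and uv: "u \<in> carrier G" "v \<in> carrier G"
  shows "(u, v) \<in> parcs (cayley_graph G (difference_set G A)) \<longleftrightarrow>
           u \<noteq> v \<and> (\<exists>x\<in>A. \<exists>y\<in>A. x \<otimes> v = y \<otimes> u)"
proof -
  have "v \<otimes> inv u = \<one> \<longleftrightarrow> u = v"
    using uv by (metis inv_equality inv_inv inv_closed r_inv)
  moreover have "v \<otimes> inv u = inv x \<otimes> y \<longleftrightarrow> x \<otimes> v = y \<otimes> u" if "x \<in> A" "y \<in> A" for x y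
  proof -
    have car: "x \<in> carrier G" "y \<in> carrier G" using that A by auto
    then have "v \<otimes> inv u = inv x \<otimes> y \<longleftrightarrow> x \<otimes> (v \<otimes> inv u) = y"
      using uv by (metis inv_closed inv_solve_left m_closed)
    also have "x \<otimes> (v \<otimes> inv u) = (x \<otimes> v) \<otimes> inv u" using car uv by (simp add: m_assoc)
    also have "(x \<otimes> v) \<otimes> inv u = y \<longleftrightarrow> x \<otimes> v = y \<otimes> u"
      using car uv by (metis inv_solve_right m_closed)
    finally show ?thesis .
  qed
  ultimately show ?thesis using uv by (fastforce simp: cayley_graph_def difference_set_def)
qed

text \<open>A packing bound: multiplication is injective on \<open>A \<times> I\<close>. A collision
  \<open>x \<otimes> u = y \<otimes> v\<close> with \<open>u \<noteq> v\<close> would be an arc, and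
  for \<open>u = v\<close> right cancellation gives \<open>x = y\<close>.\<close>

lemma card_independent_set_difference_set:
  assumes fin: "finite (carrier G)" and A: "A \<subseteq> carrier G"
    and I: "independent_set (cayley_graph G (difference_set G A)) I"
  shows "card A * card I \<le> card (carrier G)"
proof -
  have IG: "I \<subseteq> carrier G" using I by (simp add: independent_set_def cayley_graph_def)
  have "inj_on (\<lambda>(x, u). x \<otimes> u) (A \<times> I)"
  proof (rule inj_onI, clarsimp)
    fix x u y v assume *: "x \<in> A" "u \<in> I" "y \<in> A" "v \<in> I" "x \<otimes> u = y \<otimes> v"
    then have car: "x \<in> carrier G" "u \<in> carrier G" "y \<in> carrier G" "v \<in> carrier G"
      using A IG by auto
    have "(v, u) \<notin> parcs (cayley_graph G (difference_set G A))"
      using I * by (simp add: independent_set_def)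
    then have "u = v"
      using parcs_cayley_graph_difference_set[OF A car(4,2)] * by blast
    then show "x = y \<and> u = v" using * car by simp
  qed
  then have "card (A \<times> I) \<le> card (carrier G)"
    by (rule card_inj_on_le) (use A IG fin in auto)
  then show ?thesis by (simp add: card_cartesian_product)
qed

text \<open>Diagonal pairs yield only the identity, which is removed, so the off-diagonal pairs map
  onto the difference set.\<close>

lemma card_difference_set_le:
  assumes A: "finite A" "A \<subseteq> carrier G"
  shows "card (difference_set G A) \<le> card A * (card A - 1)"
proof -
  let ?P = "A \<times> A - (\<lambda>x. (x, x)) ` A"
  have "difference_set G A \<subseteq> (\<lambda>(x, y). inv x \<otimes> y) ` ?P"
    using A(2) by (fastforce simp: difference_set_def)
  then have "card (difference_set G A) \<le> card ?P"
    using A by (meson card_image_le card_mono finite_Diff finite_SigmaI finite_imageI order_trans)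
  also have "\<dots> = card A * (card A - 1)"
    using A by (subst card_Diff_subset)
      (auto simp: card_cartesian_product card_image inj_on_def diff_mult_distrib2)
  finally show ?thesis .
qed

text \<open>The covering counterpart: by domination every vertex lies in \<open>I\<close> or is a
  product of an element of the difference set and an element of \<open>I\<close>.\<close>

lemma card_carrier_le_maximal_independent_set_difference_set:
  assumes fin: "finite (carrier G)" and A: "A \<subseteq> carrier G"
    and M: "maximal_independent_set (cayley_graph G (difference_set G A)) I"
  shows "card (carrier G) \<le> (card A * (card A - 1) + 1) * card I"
proof -
  let ?S = "difference_set G A"
  interpret \<Gamma>: pair_bidirected_digraph "cayley_graph G ?S"
    by (rule difference_set_cayley_graph_simple[OF A])
  have I: "independent_set (cayley_graph G ?S) I"
    and dom: "\<And>v. v \<in> carrier G \<Longrightarrow> v \<in> I \<or> (\<exists>u\<in>I. v \<otimes> inv u \<in> ?S)"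
    using M unfolding \<Gamma>.maximal_independent_set_iff_dominating
    by (auto simp: cayley_graph_def)
  have IG: "I \<subseteq> carrier G" using I by (simp add: independent_set_def cayley_graph_def)
  have "?S \<subseteq> carrier G" using A by (auto simp: difference_set_def)
  then have fins: "finite I" "finite A" "finite ?S"
    using fin IG A by (auto intro: finite_subset)
  have "carrier G \<subseteq> I \<union> (\<lambda>(s, u). s \<otimes> u) ` (?S \<times> I)"
  proof
    fix v assume v: "v \<in> carrier G"
    have "v = (v \<otimes> inv u) \<otimes> u" if "u \<in> I" for u
      using v that IG by (auto simp: m_assoc)
    then show "v \<in> I \<union> (\<lambda>(s, u). s \<otimes> u) ` (?S \<times> I)" using dom[OF v] by force
  qed
  then have "card (carrier G) \<le> card (I \<union> (\<lambda>(s, u). s \<otimes> u) ` (?S \<times> I))"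
    using fins by (intro card_mono) auto
  also have "\<dots> \<le> card I + card (?S \<times> I)"
    using fins by (meson add_left_mono card_Un_le card_image_le finite_SigmaI order_trans)
  also have "\<dots> \<le> (card A * (card A - 1) + 1) * card I"
    using card_difference_set_le[OF fins(2) A] by (simp add: card_cartesian_product)
  finally show ?thesis .
qed

end

section \<open>The Heisenberg group over the field of three elements\<close>

text \<open>The triple \<open>(i, j, k)\<close> stands for \<open>a\<^sup>i b\<^sup>j c\<^sup>k\<close>; the product comes from \<open>b a = a b c\<close>.\<close>

definition heis_mult :: "nat \<times> nat \<times> nat \<Rightarrow> nat \<times> nat \<times> nat \<Rightarrow> nat \<times> nat \<times> nat" where
  "heis_mult = (\<lambda>(i, j, k) (i', j', k'). ((i + i') mod 3, (j + j') mod 3, (k + k' + j * i') mod 3))"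

text \<open>A formal inverse gets the exponent 2, which is -1 modulo 3.\<close>

fun heis_letter :: "gen \<times> bool \<Rightarrow> nat \<times> nat \<times> nat" where
  "heis_letter (Ga, s) = (if s then 1 else 2, 0, 0)"
| "heis_letter (Gb, s) = (0, if s then 1 else 2, 0)"
| "heis_letter (Gc, s) = (0, 0, if s then 1 else 2)"

fun heis_val :: "gen word \<Rightarrow> nat \<times> nat \<times> nat" where
  "heis_val [] = (0, 0, 0)"
| "heis_val (p # u) = heis_mult (heis_letter p) (heis_val u)"

definition heis_triples :: "(nat \<times> nat \<times> nat) set" where
  "heis_triples = {..<3} \<times> {..<3} \<times> {..<3}"

lemma heis_triples_explicit: "heis_triples = {0, 1, 2} \<times> {0, 1, 2} \<times> {0, 1, 2}"
proof -
  have "{..<3} = {0, 1, 2::nat}" by auto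
  then show ?thesis by (simp add: heis_triples_def)
qed

lemma heis_mult_assoc: "heis_mult (heis_mult x y) z = heis_mult x (heis_mult y z)"
proof -
  \<comment> \<open>Only the third coordinate needs work. Since the correction term
    \<open>j * i'\<close> is bilinear, both sides are k + k' + k'' + j i' + j i'' + j' i'' modulo
    3.\<close>
  have "((k + k' + j * i') mod 3 + k'' + (j + j') mod 3 * i'') mod 3 =
        (k + (k' + k'' + j' * i'') mod 3 + j * ((i' + i'') mod 3)) mod 3"
    for i' i'' j j' k k' k'' :: nat
  proof -
    have "((k + k' + j * i') mod 3 + k'' + (j + j') mod 3 * i'') mod 3 =
          (k + k' + j * i' + k'' + (j + j') * i'') mod 3"
      by (intro mod_add_cong mod_mult_cong) simp_all
    also have "\<dots> = (k + (k' + k'' + j' * i'') + j * (i' + i'')) mod 3" by (simp add: algebra_simps)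
    also have "\<dots> = (k + (k' + k'' + j' * i'') mod 3 + j * ((i' + i'') mod 3)) mod 3"
      by (intro mod_add_cong mod_mult_cong) simp_all
    finally show ?thesis .
  qed
  then show ?thesis by (cases x; cases y; cases z) (simp add: heis_mult_def mod_simps add.assoc)
qed

lemma heis_mult_in_triples: "heis_mult x y \<in> heis_triples"
  by (cases x; cases y) (simp add: heis_mult_def heis_triples_def)

lemma heis_mult_zero_left: "x \<in> heis_triples \<Longrightarrow> heis_mult (0, 0, 0) x = x"
  by (auto simp: heis_mult_def heis_triples_def)

lemma heis_val_in_triples: "heis_val u \<in> heis_triples"
  by (cases u) (simp_all add: heis_mult_in_triples, simp add: heis_triples_def)

lemma heis_val_append: "heis_val (u @ v) = heis_mult (heis_val u) (heis_val v)"
  by (induction u) (simp_all add: heis_mult_assoc heis_mult_zero_left heis_val_in_triples)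

text \<open>The triples satisfy the defining relations, so evaluation descends to the presented
  group. Words with different values stay distinct there, so the 27 normal forms do not
  collapse.\<close>

lemma heis_val_cong:
  assumes "word_eq heisenberg_relations u v"
  shows "heis_val u = heis_val v"
  using assms
proof (induction rule: word_eq.induct)
  case (cancel u x s v)
  have "heis_val [(x, s), (x, \<not> s)] = heis_val []"
    by (cases x; cases s) (simp_all add: heis_mult_def)
  then show ?case
    by (simp only: heis_val_append heis_val.simps(1) heis_mult_zero_left heis_val_in_triples)
next
  case (relation l r u v)
  then have "heis_val l = heis_val r"
    by (auto simp: heisenberg_relations_def heis_mult_def)
  then show ?case by (simp only: heis_val_append)
qed simp_all

section \<open>Normal forms and the word problem\<close>

definition heis_word :: "nat \<times> nat \<times> nat \<Rightarrow> gen word" where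
  "heis_word = (\<lambda>(i, j, k). replicate i (Ga, True) @ replicate j (Gb, True) @ replicate k (Gc, True))"

lemma heis_val_word: "t \<in> heis_triples \<Longrightarrow> heis_val (heis_word t) = t"
  by (auto simp: heis_triples_explicit heis_word_def heis_mult_def numeral_2_eq_2)

text \<open>The products of powers of a, b, c in this order contain the identity and are closed
  under left multiplication by the generators. Induction on words therefore reaches every class, and
  the exponents reduce modulo 3. Hence the order is at most 27.\<close>

lemma carrier_heisenberg_subset:
  "carrier (presented_group heisenberg_relations)
     \<subseteq> (\<lambda>t. word_class heisenberg_relations (heis_word t)) ` heis_triples"
proof -
  define R where "R = heisenberg_relations"
  define G where "G = presented_group R"
  interpret group G unfolding G_def by (rule group_presented_group)
  note simps = presented_group_simps[of R, folded G_def]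
  define P where "P = pgen R"
  define N where "N g = word_class R [(g, False)]" for g
  have car [simp]: "P g \<in> carrier G" "N g \<in> carrier G" for g
    by (auto simp: simps P_def pgen_def N_def)
  have NP: "N g \<otimes>\<^bsub>G\<^esub> P g = \<one>\<^bsub>G\<^esub>" for g
    using word_eq.cancel[of R "[]" g False "[]"]
    by (simp add: simps P_def pgen_def N_def word_class_eq_iff)
  have rel: "word_class R l = word_class R r" if "(l, r) \<in> R" for l r
    using word_eq.relation[OF that, of "[]" "[]"] by (simp add: word_class_eq_iff)
  have cube: "P g \<otimes>\<^bsub>G\<^esub> (P g \<otimes>\<^bsub>G\<^esub> P g) = \<one>\<^bsub>G\<^esub>" for g
  proof -
    have "([(g, True), (g, True), (g, True)], []) \<in> R"
      by (cases g) (simp_all add: R_def heisenberg_relations_def)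
    from rel[OF this] show ?thesis by (simp add: simps P_def pgen_def)
  qed
  have comm: "N Gb \<otimes>\<^bsub>G\<^esub> (N Ga \<otimes>\<^bsub>G\<^esub> (P Gb \<otimes>\<^bsub>G\<^esub> P Ga)) = P Gc"
    and ac: "P Ga \<otimes>\<^bsub>G\<^esub> P Gc = P Gc \<otimes>\<^bsub>G\<^esub> P Ga"
    and bc: "P Gb \<otimes>\<^bsub>G\<^esub> P Gc = P Gc \<otimes>\<^bsub>G\<^esub> P Gb"
    by (auto simp: simps P_def pgen_def N_def intro!: rel) (auto simp: R_def heisenberg_relations_def)
  have N_inv: "N g = inv\<^bsub>G\<^esub> P g" for g
    using inv_equality[OF NP] by simp
  \<comment> \<open>An inverse letter acts as its generator applied twice, so closure under the
    generators alone covers letters of both signs.\<close>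
  have N_sq: "N g = P g \<otimes>\<^bsub>G\<^esub> P g" for g
    unfolding N_inv using inv_equality[of "P g \<otimes>\<^bsub>G\<^esub> P g" "P g"] cube by (simp add: m_assoc)
  have cancel: "x \<otimes>\<^bsub>G\<^esub> (inv\<^bsub>G\<^esub> x \<otimes>\<^bsub>G\<^esub> z) = z" if "x \<in> carrier G" "z \<in> carrier G" for x z
    using that by (simp flip: m_assoc)
  \<comment> \<open>Multiplying the commutator relation by \<open>a b\<close> from the left gives
    the rule that moves b past a.\<close>
  have ba: "P Gb \<otimes>\<^bsub>G\<^esub> P Ga = P Ga \<otimes>\<^bsub>G\<^esub> P Gb \<otimes>\<^bsub>G\<^esub> P Gc"
    unfolding comm[symmetric] N_inv by (simp add: m_assoc cancel)
  define F where
    "F = (\<lambda>(i::nat, j::nat, k::nat). P Ga [^]\<^bsub>G\<^esub> i \<otimes>\<^bsub>G\<^esub> P Gb [^]\<^bsub>G\<^esub> j \<otimes>\<^bsub>G\<^esub> P Gc [^]\<^bsub>G\<^esub> k)"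
  have step: "P g \<otimes>\<^bsub>G\<^esub> x \<in> range F" if x_in: "x \<in> range F" for g x
  proof -
    obtain t where t: "x = F t" using x_in by blast
    obtain i j k where "t = (i, j, k)" by (cases t)
    with t have x: "x = F (i, j, k)" by simp
    have "P g \<in> {P Ga, P Gb, P Gc}" by (cases g) auto
    from heisenberg_normal_form_left[OF car(1) car(1) car(1) ba ac bc this, of i j k]
    obtain i' j' k' where "P g \<otimes>\<^bsub>G\<^esub> x = F (i', j', k')" unfolding x F_def prod.case by blast
    then show ?thesis by blast
  qed
  have in_range: "word_class R u \<in> range F" for u
  proof (induction u)
    case Nil
    have "word_class R [] = F (0, 0, 0)" by (simp add: F_def simps)
    then show ?case by blast
  next
    case (Cons p u)
    obtain g s where p: "p = (g, s)" by fastforce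
    have "word_class R (p # u) = (if s then P g else N g) \<otimes>\<^bsub>G\<^esub> word_class R u"
      by (simp add: p P_def pgen_def N_def simps)
    moreover have "word_class R u \<in> carrier G" by (simp add: simps)
    ultimately have "word_class R (p # u) \<in> {P g \<otimes>\<^bsub>G\<^esub> word_class R u,
        P g \<otimes>\<^bsub>G\<^esub> (P g \<otimes>\<^bsub>G\<^esub> word_class R u)}"
      by (simp add: N_sq m_assoc)
    then show ?case using step[OF Cons.IH] step[OF step[OF Cons.IH]] by blast
  qed
  have pow: "P g [^]\<^bsub>G\<^esub> n = word_class R (replicate n (g, True))" for g and n :: nat
  proof (induction n)
    case (Suc n)
    then show ?case
      by (simp add: P_def pgen_def simps replicate_append_same del: replicate_Suc)
        (simp add: replicate_append_same)
  qed (simp add: simps)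
  \<comment> \<open>The exponents reduce because the cubes of the generators are trivial;
    \<open>pow\<close> then turns powers into words.\<close>
  have "F (i, j, k) = word_class R (heis_word (i mod 3, j mod 3, k mod 3))" for i j k
  proof -
    have "F (i, j, k) = F (i mod 3, j mod 3, k mod 3)"
      unfolding F_def prod.case
      by (intro arg_cong2[where f = "monoid.mult G"] pow_mod_3 car cube)
    then show ?thesis by (simp add: F_def pow simps heis_word_def)
  qed
  moreover have "(i mod 3, j mod 3, k mod 3) \<in> heis_triples" for i j k :: nat
    by (simp add: heis_triples_def)
  ultimately have "F t \<in> (\<lambda>t. word_class R (heis_word t)) ` heis_triples" for t
    by (cases t) blast
  then have "range F \<subseteq> (\<lambda>t. word_class R (heis_word t)) ` heis_triples" by blast
  then show ?thesis using in_range by (auto simp: presented_group_simps simp flip: R_def)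
qed

lemma word_eq_heisenberg_iff:
  "word_eq heisenberg_relations u v \<longleftrightarrow> heis_val u = heis_val v"
proof
  have "word_eq heisenberg_relations w (heis_word (heis_val w))" for w
  proof -
    have "word_class heisenberg_relations w \<in> carrier (presented_group heisenberg_relations)"
      by (simp add: presented_group_simps)
    then obtain t where "t \<in> heis_triples" "word_eq heisenberg_relations w (heis_word t)"
      using carrier_heisenberg_subset by (auto simp: word_class_eq_iff)
    \<comment> \<open>Evaluating both sides of the equivalence shows that \<open>t\<close> is the
      value of \<open>w\<close>.\<close>
    then show ?thesis using heis_val_cong heis_val_word by metis
  qed
  then show "heis_val u = heis_val v \<Longrightarrow> word_eq heisenberg_relations u v"
    by (metis word_eq.sym word_eq.trans)
qed (rule heis_val_cong)

definition heis_elem :: "nat \<times> nat \<times> nat \<Rightarrow> gen word set" where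
  "heis_elem t = word_class heisenberg_relations (heis_word t)"

text \<open>Both sides are classes of words with the same value. With injectivity and surjectivity
  below, \<open>heis_elem\<close> is an isomorphism from the triples under \<open>heis_mult\<close>
  onto the presented group.\<close>

lemma heis_elem_mult:
  assumes "s \<in> heis_triples" "t \<in> heis_triples"
  shows "heis_elem s \<otimes>\<^bsub>presented_group heisenberg_relations\<^esub> heis_elem t = heis_elem (heis_mult s t)"
  using assms
  by (simp add: heis_elem_def presented_group_simps word_class_eq_iff word_eq_heisenberg_iff
      heis_val_append heis_val_word heis_mult_in_triples)

lemma heis_elem_eq_iff:
  "s \<in> heis_triples \<Longrightarrow> t \<in> heis_triples \<Longrightarrow> heis_elem s = heis_elem t \<longleftrightarrow> s = t"
  by (simp add: heis_elem_def word_class_eq_iff word_eq_heisenberg_iff heis_val_word)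

lemma inj_on_heis_elem: "inj_on heis_elem heis_triples"
  by (simp add: inj_on_def heis_elem_eq_iff)

lemma carrier_heisenberg: "carrier (presented_group heisenberg_relations) = heis_elem ` heis_triples"
  using carrier_heisenberg_subset by (auto simp: heis_elem_def presented_group_simps)

lemma card_carrier_heisenberg: "card (carrier (presented_group heisenberg_relations)) = 27"
  by (simp add: carrier_heisenberg card_image inj_on_heis_elem)
    (simp add: heis_triples_def card_cartesian_product)

lemma heis_elem_generators:
  "\<one>\<^bsub>presented_group heisenberg_relations\<^esub> = heis_elem (0, 0, 0)"
  "pgen heisenberg_relations Ga = heis_elem (1, 0, 0)"
  "pgen heisenberg_relations Gb = heis_elem (0, 1, 0)"
  "pgen heisenberg_relations Gc = heis_elem (0, 0, 1)"
  by (simp_all add: heis_elem_def heis_word_def pgen_def presented_group_simps)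

section \<open>The Cayley graph in coordinates\<close>

definition heis_base :: "(nat \<times> nat \<times> nat) set" where
  "heis_base = {(0, 0, 0), (1, 0, 0), (0, 1, 0), (0, 0, 1)}"

lemma heis_base_subset: "heis_base \<subseteq> heis_triples"
  by (simp add: heis_base_def heis_triples_def)

text \<open>Adjacency in the form "the translates of the base set meet", which can be evaluated on
  triples without inverses.\<close>

definition heis_adj :: "nat \<times> nat \<times> nat \<Rightarrow> nat \<times> nat \<times> nat \<Rightarrow> bool" where
  "heis_adj s t \<longleftrightarrow> s \<noteq> t \<and> (\<exists>x\<in>heis_base. \<exists>y\<in>heis_base. heis_mult x t = heis_mult y s)"

abbreviation heis_graph :: "gen word set pair_pre_digraph" where
  "heis_graph \<equiv> cayley_graph (presented_group heisenberg_relations)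
     (difference_set (presented_group heisenberg_relations) (heis_elem ` heis_base))"

lemma parcs_heis_graph:
  assumes "s \<in> heis_triples" "t \<in> heis_triples"
  shows "(heis_elem s, heis_elem t) \<in> parcs heis_graph \<longleftrightarrow> heis_adj s t"
proof -
  have "x \<in> heis_triples" if "x \<in> heis_base" for x using that heis_base_subset by blast
  then show ?thesis
    using assms heis_base_subset
      group.parcs_cayley_graph_difference_set[OF group_presented_group,
        of "heis_elem ` heis_base" heisenberg_relations "heis_elem s" "heis_elem t"]
    by (simp add: carrier_heisenberg image_mono heis_elem_mult heis_elem_eq_iff heis_adj_def
        heis_mult_in_triples)
qed

lemma independent_set_heis_graph:
  assumes "W \<subseteq> heis_triples"
  shows "independent_set heis_graph (heis_elem ` W) \<longleftrightarrow> (\<forall>s\<in>W. \<forall>t\<in>W. \<not> heis_adj s t)"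
proof -
  have "(heis_elem s, heis_elem t) \<in> parcs heis_graph \<longleftrightarrow> heis_adj s t" if "s \<in> W" "t \<in> W" for s t
    using that assms by (intro parcs_heis_graph) auto
  moreover have "pverts heis_graph = heis_elem ` heis_triples"
    by (simp add: cayley_graph_def carrier_heisenberg)
  ultimately show ?thesis using assms by (simp add: independent_set_def image_mono)
qed

lemma heis_graph_bidirected: "pair_bidirected_digraph heis_graph"
  using heis_base_subset
  by (intro group.difference_set_cayley_graph_simple group_presented_group)
    (auto simp: carrier_heisenberg)

text \<open>Domination turns maximality into a finite check on the 27 triples.\<close>

lemma maximal_independent_set_heis_graph:
  assumes W: "W \<subseteq> heis_triples" and ind: "\<forall>s\<in>W. \<forall>t\<in>W. \<not> heis_adj s t"
    and dom: "\<forall>t\<in>heis_triples. t \<in> W \<or> (\<exists>s\<in>W. heis_adj s t)"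
  shows "maximal_independent_set heis_graph (heis_elem ` W)"
proof -
  have "v \<in> heis_elem ` W \<or> (\<exists>u\<in>heis_elem ` W. (u, v) \<in> parcs heis_graph)"
    if v: "v \<in> pverts heis_graph" for v
  proof -
    obtain t where t: "t \<in> heis_triples" "v = heis_elem t"
      using v by (auto simp: cayley_graph_def carrier_heisenberg)
    show ?thesis
    proof (cases "t \<in> W")
      case False
      then obtain s where s: "s \<in> W" "heis_adj s t" using dom t(1) by blast
      then have "(heis_elem s, v) \<in> parcs heis_graph"
        using W t parcs_heis_graph[of s t] by auto
      then show ?thesis using s(1) by blast
    qed (simp add: t(2))
  qed
  then show ?thesis
    using independent_set_heis_graph[OF W] ind
    by (simp add: pair_bidirected_digraph.maximal_independent_set_iff_dominating[OF heis_graph_bidirected])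
qed

section \<open>Sets that attain the two bounds\<close>

lemma ex_independent_set_heis_graph: "\<exists>I. independent_set heis_graph I \<and> card I = 6"
proof -
  \<comment> \<open>The translates of the base set by these six elements are disjoint and cover 24
    of the 27 elements.\<close>
  let ?W = "{(0, 0, 0), (0, 1, 1), (1, 1, 2), (1, 2, 1), (2, 0, 2), (2, 2, 2)}"
  have sub: "?W \<subseteq> heis_triples" by (simp add: heis_triples_def)
  have "\<forall>s\<in>?W. \<forall>t\<in>?W. \<not> heis_adj s t"
    by (simp add: heis_adj_def heis_base_def heis_mult_def)
  then have "independent_set heis_graph (heis_elem ` ?W)"
    using independent_set_heis_graph[OF sub] by blast
  moreover have "card (heis_elem ` ?W) = 6"
    by (subst card_image[OF inj_on_subset[OF inj_on_heis_elem sub]]) simp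
  ultimately show ?thesis by blast
qed

lemma ex_maximal_independent_set_heis_graph:
  "\<exists>I. maximal_independent_set heis_graph I \<and> card I = 3"
proof -
  \<comment> \<open>These are the powers of h = a b c, with h^2 = (2, 2, 0) and h^3 = e. For this
    subgroup, independence says that it misses the connection set, and domination says that every
    other left coset meets that set.\<close>
  let ?W = "{(0, 0, 0), (1, 1, 1), (2, 2, 0)}"
  have sub: "?W \<subseteq> heis_triples" by (simp add: heis_triples_def)
  have "maximal_independent_set heis_graph (heis_elem ` ?W)"
  proof (rule maximal_independent_set_heis_graph[OF sub])
    show "\<forall>s\<in>?W. \<forall>t\<in>?W. \<not> heis_adj s t"
      by (simp add: heis_adj_def heis_base_def heis_mult_def)
    show "\<forall>t\<in>heis_triples. t \<in> ?W \<or> (\<exists>s\<in>?W. heis_adj s t)"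
      by (simp add: heis_triples_explicit heis_adj_def heis_base_def heis_mult_def)
  qed
  moreover have "card (heis_elem ` ?W) = 3"
    by (subst card_image[OF inj_on_subset[OF inj_on_heis_elem sub]]) simp
  ultimately show ?thesis by blast
qed

theorem lemma10:
  fixes G :: "gen word set monoid" and a b c :: "gen word set" and S :: "gen word set set"
  assumes "G = presented_group heisenberg_relations"
    and "a = pgen heisenberg_relations Ga"
    and "b = pgen heisenberg_relations Gb"
    and "c = pgen heisenberg_relations Gc"
    and "S = difference_set G {\<one>\<^bsub>G\<^esub>, a, b, c}"
  shows "independent_domination_number (cayley_graph G S) = 3 \<and>
         independence_number (cayley_graph G S) = 6"
proof -
  let ?A = "heis_elem ` heis_base"
  have graph: "cayley_graph G S = heis_graph"
    by (simp add: assms heis_elem_generators heis_base_def)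
  interpret H: group "presented_group heisenberg_relations" by (rule group_presented_group)
  have A: "?A \<subseteq> carrier (presented_group heisenberg_relations)"
    using heis_base_subset by (auto simp: carrier_heisenberg)
  have card_A: "card ?A = 4"
    by (subst card_image[OF inj_on_subset[OF inj_on_heis_elem heis_base_subset]])
      (simp add: heis_base_def)
  have upper: "card I \<le> 6" if "independent_set heis_graph I" for I
    using H.card_independent_set_difference_set[OF finite_heisenberg A that] card_A
    by (simp add: card_carrier_heisenberg)
  \<comment> \<open>Here 27 \<le> 13 |I|, and two closed neighbourhoods cover at most 26 vertices,
    one too few.\<close>
  have lower: "3 \<le> card I" if "maximal_independent_set heis_graph I" for I
    using H.card_carrier_le_maximal_independent_set_difference_set[OF finite_heisenberg A that] card_A
    by (simp add: card_carrier_heisenberg)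
  \<comment> \<open>\<open>Max\<close> and \<open>Min\<close> are meaningful only for finite sets;
    the bound 6 on the sizes supplies finiteness for both.\<close>
  have fin_ind: "finite {card I | I. independent_set heis_graph I}"
    by (rule finite_subset[of _ "{..6}"]) (use upper in auto)
  have "{card I | I. maximal_independent_set heis_graph I}
          \<subseteq> {card I | I. independent_set heis_graph I}"
    by (auto simp: maximal_independent_set_def)
  then have fin_max: "finite {card I | I. maximal_independent_set heis_graph I}"
    using fin_ind by (rule finite_subset)
  have "independent_domination_number heis_graph = 3"
    unfolding independent_domination_number_def
    by (rule Min_eqI[OF fin_max])
      (use lower ex_maximal_independent_set_heis_graph in force)+
  moreover have "independence_number heis_graph = 6"
    unfolding independence_number_def
    by (rule Max_eqI[OF fin_ind])
      (use upper ex_independent_set_heis_graph in force)+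
  ultimately show ?thesis by (simp add: graph)
qed

end
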